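(* With $a_1(231;213)=a_2(231;213)=a_3(231;213)=1$, for $n\geq 4$ the numbers $a_n(231;213)$ satisfy \[ a_n(231;213) = 2a_{n-1}(231;213)-a_{n-2}(231;213)+a_{n-3}(231;213). \] In closed form, for all $n\geq 1$, \[ a_n(231;213) = \sum_{k=0}^{\lfloor (n-1)/3\rfloor}\binom{n-1-k}{2k}. \]
   Context: $\mathcal{S}_n$ is the set of permutations of $[n]=\{1,\dots,n\}$, written in one-line notation $\pi=\pi_1\pi_2\cdots\pi_n$ with $\pi_i=\pi(i)$. A permutation is cyclic if it consists of exactly one $n$-cycle. For a cyclic $\pi$, its standard cycle notation is $C(\pi)=(c_1,c_2,\dots,c_n)$ with $c_1=1$ and $c_i=\pi_{c_{i-1}}$ for $2\le i\le n$. A sequence of distinct integers $w_1\cdots w_m$ contains a pattern $\sigma\in\mathcal{S}_k$ if there are indices $i_1<\dots<i_k$ with $w_{i_1}\cdots w_{i_k}$ in the same relative order as $\sigma_1\cdots\sigma_k$; otherwise it avoids $\sigma$. For $\sigma,\tau\in\mathcal{S}_3$, $\mathcal{A}_n(\sigma;\tau)$ is the set of cyclic permutations $\pi\in\mathcal{S}_n$ whose one-line notation avoids $\sigma$ and whose cycle notation $C(\pi)$ (as the sequence $c_1c_2\cdots c_n$) avoids $\tau$; $a_n(\sigma;\tau)=|\mathcal{A}_n(\sigma;\tau)|$. *)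

theory Defs
  imports "HOL-Combinatorics.Combinatorics"
begin

text \<open>
  A permutation of \<open>[n] = {1, ..., n}\<close> is a function \<open>p\<close> with \<^term>\<open>p permutes {1..n::nat}\<close>
  (so \<open>p\<close> is the identity outside \<open>[n]\<close>, which makes it determined by its values on \<open>[n]\<close>).
  Words and patterns are lists of natural numbers.
\<close>

definition one_line :: "nat \<Rightarrow> (nat \<Rightarrow> nat) \<Rightarrow> nat list" where
  "one_line n p = map p [1..<Suc n]"

text \<open>
  The entry at list position \<open>i\<close> (counting from 0) is the \<open>i\<close>-th iterate of \<open>p\<close> at 1,
  i.e. \<open>c\<^sub>1 = 1\<close> and each further entry is the image under \<open>p\<close> of the preceding one.
  It is meaningful for cyclic \<open>p\<close> only.
\<close>

definition cycle_notation :: "nat \<Rightarrow> (nat \<Rightarrow> nat) \<Rightarrow> nat list" where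
  "cycle_notation n p = map (\<lambda>i. (p ^^ i) 1) [0..<n]"

definition contains_pattern :: "nat list \<Rightarrow> nat list \<Rightarrow> bool" where
  "contains_pattern w \<sigma> \<longleftrightarrow>
     (\<exists>f. strict_mono_on {..<length \<sigma>} f \<and> f ` {..<length \<sigma>} \<subseteq> {..<length w} \<and>
          (\<forall>i<length \<sigma>. \<forall>j<length \<sigma>. w ! f i < w ! f j \<longleftrightarrow> \<sigma> ! i < \<sigma> ! j))"

abbreviation avoids :: "nat list \<Rightarrow> nat list \<Rightarrow> bool" where
  "avoids w \<sigma> \<equiv> \<not> contains_pattern w \<sigma>"

text \<open>
  \<^const>\<open>cyclic_on\<close> says that \<open>[n]\<close> is a single orbit of \<open>p\<close>; for a permutation of \<open>[n]\<close> this means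
  that it consists of exactly one \<open>n\<close>-cycle. The identity on \<open>[1]\<close> is cyclic.
\<close>

definition cyclic_avoiders :: "nat \<Rightarrow> nat list \<Rightarrow> nat list \<Rightarrow> (nat \<Rightarrow> nat) set" where
  "cyclic_avoiders n \<sigma> \<tau> =
     {p. p permutes {1..n} \<and> cyclic_on p {1..n} \<and>
         avoids (one_line n p) \<sigma> \<and> avoids (cycle_notation n p) \<tau>}"

definition num_cyclic_avoiders :: "nat \<Rightarrow> nat list \<Rightarrow> nat list \<Rightarrow> nat" where
  "num_cyclic_avoiders n \<sigma> \<tau> = card (cyclic_avoiders n \<sigma> \<tau>)"

end

theory Submission
  imports Defs
begin

text \<open>
  Write the cycle notation of a cyclic permutation of \<open>[n]\<close> as \<open>1\<close> followed by a word \<open>w\<close> on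
  \<open>{2..n}\<close>; the one-line notation is then read off the consecutive pairs of \<open>1 w 1\<close>. If \<open>w\<close>
  comes from an avoider and \<open>n \<ge> 2\<close>, then \<open>w\<close> starts with \<open>n\<close>: a first letter \<open>k < n\<close> followed
  by a smaller letter gives the pattern 213 together with \<open>n\<close>, and followed by a larger letter it gives
  the pattern 231 in one-line notation, since the walk must later cross from above \<open>k\<close> to below \<open>k\<close>.
  Let \<open>j\<close> be the letter after \<open>n\<close>. If \<open>j < n - 1\<close>, avoidance of 213 puts all letters greater than \<open>j\<close>
  before all letters smaller than \<open>j\<close>, and as \<open>n\<close> is mapped to \<open>j\<close>, avoidance of 231 makes the
  permutation decreasing on the steps inside \<open>{j..n}\<close>. So \<open>w\<close> starts with the zigzag
  \<open>n, j, n - 1, j + 1, n - 2, \<dots>\<close>, and the remaining word on \<open>{2..j - 1}\<close> is an arbitrary avoider of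
  size \<open>j - 1\<close>. The case \<open>j = n - 1\<close> (or \<open>n = 2\<close>) is a zigzag of length one on \<open>{n}\<close>. Hence
  \<open>a\<^sub>n = a\<^sub>n\<^sub>-\<^sub>1 + (a\<^sub>1 + \<dots> + a\<^sub>n\<^sub>-\<^sub>3)\<close>, which yields the recurrence; the binomial sum satisfies it
  by Pascal's rule.
\<close>

section \<open>Words, their steps, and avoidance conditions on them\<close>

fun edges :: "'a list \<Rightarrow> ('a \<times> 'a) set" where
  "edges (x # y # zs) = insert (x, y) (edges (y # zs))"
| "edges _ = {}"

text \<open>A set of argument-value pairs stands in for the one-line notation, so the condition
  passes to subsets of steps, whatever their order along the cycle. The letters 2, 3, 1 of the
  pattern are the values \<open>a\<close>, \<open>b\<close>, \<open>c\<close>.\<close>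

definition av231 :: "('a::linorder \<times> 'a) set \<Rightarrow> bool" where
  "av231 R \<longleftrightarrow> (\<forall>(x, a) \<in> R. \<forall>(y, b) \<in> R. \<forall>(z, c) \<in> R. x < y \<longrightarrow> y < z \<longrightarrow> c < a \<longrightarrow> \<not> a < b)"

fun av213 :: "'a::linorder list \<Rightarrow> bool" where
  "av213 [] = True"
| "av213 (x # xs) \<longleftrightarrow> sorted_wrt (\<lambda>a b. \<not> (a < x \<and> x < b)) xs \<and> av213 xs"

text \<open>
  Zigzags through \<open>{l..<l + m}\<close>: from the top, \<open>l + m - 1, l, l + m - 2, l + 1, \<dots>\<close>, and from the
  bottom, \<open>l, l + m - 1, l + 1, \<dots>\<close>.
\<close>

fun zig zag :: "nat \<Rightarrow> nat \<Rightarrow> nat list" where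
  "zig l 0 = []"
| "zig l (Suc m) = (l + m) # zag l m"
| "zag l 0 = []"
| "zag l (Suc m) = l # zig (Suc l) m"

definition decreasing_edges :: "('a::linorder \<times> 'a) set \<Rightarrow> bool" where
  "decreasing_edges R \<longleftrightarrow> (\<forall>(x, a) \<in> R. \<forall>(y, b) \<in> R. x < y \<longrightarrow> b < a)"

lemma edges_Cons: "ys \<noteq> [] \<Longrightarrow> edges (x # ys) = insert (x, hd ys) (edges ys)"
  by (cases ys) auto

lemma edges_subset_Cons: "edges xs \<subseteq> edges (x # xs)"
  by (cases xs) auto

lemma edges_append:
  "xs \<noteq> [] \<Longrightarrow> ys \<noteq> [] \<Longrightarrow> edges (xs @ ys) = edges xs \<union> insert (last xs, hd ys) (edges ys)"
  by (induction xs rule: edges.induct) (auto simp: edges_Cons)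

lemma edges_subset: "edges xs \<subseteq> set (butlast xs) \<times> set (tl xs)"
  by (induction xs rule: edges.induct) auto

lemma edge_into: "y \<in> set (tl xs) \<Longrightarrow> \<exists>x \<in> set (butlast xs). (x, y) \<in> edges xs"
  by (induction xs rule: edges.induct) auto

lemma edges_target_inj: "distinct xs \<Longrightarrow> (x, y) \<in> edges xs \<Longrightarrow> (x', y) \<in> edges xs \<Longrightarrow> x = x'"
proof (induction xs rule: edges.induct)
  case (1 a b zs)
  have "b \<notin> set (tl (b # zs))" using 1(2) by simp
  then show ?case using 1 edges_subset[of "b # zs"] by auto
qed auto

lemma set_tail: "distinct (x # xs) \<Longrightarrow> set (x # xs) = A \<Longrightarrow> set xs = A - {x}"
  by auto

text \<open>The walk never visits \<open>k\<close>, so its first letter below \<open>k\<close> is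
  reached from a letter above \<open>k\<close>.\<close>

lemma edge_crossing:
  fixes k :: "'a::linorder"
  assumes "xs \<noteq> []" "k < hd xs" "last xs < k" "k \<notin> set xs"
  shows "\<exists>x y. (x, y) \<in> edges xs \<and> k < x \<and> y < k"
  using assms
proof (induction xs rule: edges.induct)
  case (1 x y zs)
  then show ?case
    by (cases "y < k") (auto simp: not_less le_less)
qed auto

lemma av231_D:
  "av231 R \<Longrightarrow> (x, a) \<in> R \<Longrightarrow> (y, b) \<in> R \<Longrightarrow> (z, c) \<in> R \<Longrightarrow> x < y \<Longrightarrow> y < z \<Longrightarrow> c < a \<Longrightarrow> a < b \<Longrightarrow> False"
  by (fastforce simp: av231_def)

lemma av231_mono: "av231 R \<Longrightarrow> S \<subseteq> R \<Longrightarrow> av231 S"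
  unfolding av231_def by blast

lemma decreasing_edges_D:
  "decreasing_edges R \<Longrightarrow> (x, a) \<in> R \<Longrightarrow> (y, b) \<in> R \<Longrightarrow> x < y \<Longrightarrow> b < a"
  by (fastforce simp: decreasing_edges_def)

lemma decreasing_edges_mono: "decreasing_edges R \<Longrightarrow> S \<subseteq> R \<Longrightarrow> decreasing_edges S"
  unfolding decreasing_edges_def by blast

lemma decreasing_edges_insert:
  "decreasing_edges (insert (x, a) R) \<longleftrightarrow>
     decreasing_edges R \<and> (\<forall>(y, b) \<in> R. (x < y \<longrightarrow> b < a) \<and> (y < x \<longrightarrow> a < b))"
  unfolding decreasing_edges_def by (simp add: split_beta) blast

section \<open>Zigzags as the words with decreasing steps\<close>

lemma insert_range:
  "insert (l + m) {l..<l + m} = {l..<l + Suc m}" "insert l {Suc l..<Suc l + m} = {l..<l + Suc m}"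
  by (rule set_eqI, simp, linarith)+

lemma range_Diff:
  "{l..<l + Suc m} - {l + m} = {l..<l + m}" "{l..<l + Suc m} - {l} = {Suc l..<Suc l + m}"
  by (rule set_eqI, simp, linarith)+

lemma set_zig_zag: "set (zig l m) = {l..<l + m}" "set (zag l m) = {l..<l + m}"
  by (induction l m and l m rule: zig_zag.induct)
    (simp_all only: zig.simps zag.simps list.set insert_range, simp_all)

lemma distinct_zig_zag: "distinct (zig l m)" "distinct (zag l m)"
  by (induction l m and l m rule: zig_zag.induct) (auto simp: set_zig_zag)

lemma sorted_wrt_const: "(\<And>a b. a \<in> set xs \<Longrightarrow> b \<in> set xs \<Longrightarrow> P a b) \<Longrightarrow> sorted_wrt P xs"
  by (induction xs) auto

text \<open>Each letter of a zigzag is the largest or the smallest of those from it on, so none can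
  be the 2 of a pattern 213.\<close>

lemma av213_zig_zag: "av213 (zig l m)" "av213 (zag l m)"
  by (induction l m and l m rule: zig_zag.induct) (auto simp: set_zig_zag intro!: sorted_wrt_const)

text \<open>The first step joins the two extreme letters. If it falls from top to bottom, all later
  steps start lower and end higher; if it rises, the reverse holds.\<close>

lemma decreasing_edges_zig_zag:
  "decreasing_edges (edges (zig l m))" "decreasing_edges (edges (zag l m))"
proof (induction l m and l m rule: zig_zag.induct)
  case (2 l m)
  show ?case
  proof (cases "m = 0")
    case False
    have "x < l + m \<and> l < y" if "(x, y) \<in> edges (zag l m)" for x y
    proof -
      have "x \<in> set (zag l m)" "y \<in> set (tl (zag l m))"
        using that edges_subset[of "zag l m"] by (auto dest: in_set_butlastD)
      with False show ?thesis by (cases m) (auto simp: set_zig_zag)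
    qed
    moreover have "edges (zig l (Suc m)) = insert (l + m, l) (edges (zag l m))"
      using False by (cases m) (simp_all add: edges_Cons)
    ultimately show ?thesis
      using 2 by (fastforce simp: decreasing_edges_insert)
  qed (auto simp: decreasing_edges_def)
next
  case (4 l m)
  show ?case
  proof (cases "m = 0")
    case False
    have "l < x \<and> y < l + m" if "(x, y) \<in> edges (zig (Suc l) m)" for x y
    proof -
      have "x \<in> set (zig (Suc l) m)" "y \<in> set (tl (zig (Suc l) m))"
        using that edges_subset[of "zig (Suc l) m"] by (auto dest: in_set_butlastD)
      with False show ?thesis by (cases m) (auto simp: set_zig_zag)
    qed
    moreover have "edges (zag l (Suc m)) = insert (l, l + m) (edges (zig (Suc l) m))"
      using False by (cases m) (simp_all add: edges_Cons)
    ultimately show ?thesis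
      using 4 by (fastforce simp: decreasing_edges_insert)
  qed (auto simp: decreasing_edges_def)
qed (auto simp: decreasing_edges_def)

text \<open>An extreme first letter must be followed by the opposite extreme. Otherwise that extreme
  is the target of a later step, and comparison with this step pushes the target of the first step
  out of the interval.\<close>

lemma decreasing_edges_imp_zig_zag:
  "distinct xs \<Longrightarrow> set xs = {l..<l + m} \<Longrightarrow> decreasing_edges (edges xs) \<Longrightarrow>
     (0 < m \<Longrightarrow> hd xs = l + m - 1) \<Longrightarrow> xs = zig l m"
  "distinct xs \<Longrightarrow> set xs = {l..<l + m} \<Longrightarrow> decreasing_edges (edges xs) \<Longrightarrow>
     (0 < m \<Longrightarrow> hd xs = l) \<Longrightarrow> xs = zag l m"
proof (induction l m and l m arbitrary: xs and xs rule: zig_zag.induct)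
  case (2 l m)
  obtain u where u: "xs = (l + m) # u"
    using 2(3,5) by (cases xs) auto
  have set_u: "set u = {l..<l + m}"
    using set_tail[OF 2(2)[unfolded u] 2(3)[unfolded u]] unfolding range_Diff .
  have "hd u = l" if "0 < m"
  proof (rule ccontr)
    assume ne: "hd u \<noteq> l"
    have "u \<noteq> []" "l \<in> set u" using set_u that by auto
    then have "l \<in> set (tl u)" using ne by (cases u) simp_all
    then obtain x where x: "x \<in> set (butlast u)" "(x, l) \<in> edges u" using edge_into[of l u] by auto
    have "x < l + m" using in_set_butlastD[OF x(1)] set_u by simp
    moreover have "edges xs = insert (l + m, hd u) (edges u)" using \<open>u \<noteq> []\<close> by (simp add: u edges_Cons)
    ultimately have "hd u < l"
      using x(2) by (intro decreasing_edges_D[OF 2(4), of x l "l + m" "hd u"]) simp_all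
    moreover have "hd u \<in> set u" using \<open>u \<noteq> []\<close> by simp
    ultimately show False using set_u by simp
  qed
  moreover have "decreasing_edges (edges u)"
    by (rule decreasing_edges_mono[OF 2(4)]) (simp add: u edges_subset_Cons)
  ultimately have "u = zag l m" using 2(2) set_u u by (intro 2(1)) simp_all
  with u show ?case by simp
next
  case (4 l m)
  obtain u where u: "xs = l # u"
    using 4(3,5) by (cases xs) auto
  have set_u: "set u = {Suc l..<Suc l + m}"
    using set_tail[OF 4(2)[unfolded u] 4(3)[unfolded u]] unfolding range_Diff .
  have "hd u = Suc l + m - 1" if "0 < m"
  proof (rule ccontr)
    assume ne: "hd u \<noteq> Suc l + m - 1"
    have "u \<noteq> []" "l + m \<in> set u" using set_u that by auto
    then have "l + m \<in> set (tl u)" using ne by (cases u) simp_all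
    then obtain x where x: "x \<in> set (butlast u)" "(x, l + m) \<in> edges u" using edge_into[of "l + m" u] by auto
    have "l < x" using in_set_butlastD[OF x(1)] set_u by simp
    moreover have "edges xs = insert (l, hd u) (edges u)" using \<open>u \<noteq> []\<close> by (simp add: u edges_Cons)
    ultimately have "l + m < hd u"
      using x(2) by (intro decreasing_edges_D[OF 4(4), of l "hd u" x "l + m"]) simp_all
    moreover have "hd u \<in> set u" using \<open>u \<noteq> []\<close> by simp
    ultimately show False using set_u by simp
  qed
  moreover have "decreasing_edges (edges u)"
    by (rule decreasing_edges_mono[OF 4(4)]) (simp add: u edges_subset_Cons)
  ultimately have "u = zig (Suc l) m" using 4(2) set_u u by (intro 4(1)) simp_all
  with u show ?case by simp
qed simp_all

section \<open>Splitting avoider words into a zigzag and a smaller avoider word\<close>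

text \<open>The 3 of a pattern 213 is its last and largest letter, so an occurrence cannot mix
  letters of \<open>u\<close> and \<open>d\<close>.\<close>

lemma av213_append:
  "av213 u \<Longrightarrow> av213 d \<Longrightarrow> (\<And>x y. x \<in> set u \<Longrightarrow> y \<in> set d \<Longrightarrow> y < x) \<Longrightarrow> av213 (u @ d)"
  by (induction u) (auto simp: sorted_wrt_append intro!: sorted_wrt_const dest: less_asym)

lemma av213_appendD: "av213 (u @ d) \<Longrightarrow> av213 d"
  by (induction u) auto

text \<open>The sortedness hypothesis is what \<open>av213 (x # xs)\<close> says about its head. The
  lemma serves to separate the leading block from the rest of the word.\<close>

lemma split_big_small:
  "sorted_wrt (\<lambda>a b. \<not> (a < x \<and> x < b)) xs \<Longrightarrow> x \<notin> set xs \<Longrightarrow>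
     xs = filter (\<lambda>y. x < y) xs @ filter (\<lambda>y. y < (x::'a::linorder)) xs"
proof (induction xs)
  case (Cons a xs)
  show ?case
  proof (cases "x < a")
    case True
    with Cons show ?thesis by auto
  next
    case False
    with Cons have "a < x" by auto
    with Cons have "b < x" if "b \<in> set xs" for b
      using that by (cases b x rule: linorder_cases) auto
    then have "filter (\<lambda>y. x < y) xs = []" "filter (\<lambda>y. y < x) xs = xs"
      by (auto simp: filter_empty_conv intro: less_asym)
    with \<open>a < x\<close> False show ?thesis by simp
  qed
qed simp

text \<open>The leading letter 1 of the cycle notation cannot take part in a pattern 213.\<close>

definition avoider_words :: "nat \<Rightarrow> nat list set" where
  "avoider_words n = {w. distinct w \<and> set w = {2..n} \<and> av213 w \<and> av231 (edges (1 # w @ [1]))}"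

lemma hd_avoider_word:
  assumes w: "w \<in> avoider_words n" and n: "2 \<le> n"
  shows "hd w = n"
proof (rule ccontr)
  assume ne: "hd w \<noteq> n"
  have w': "distinct w" "set w = {2..n}" "av213 w" "av231 (edges (1 # w @ [1]))"
    using w by (auto simp: avoider_words_def)
  have mem: "x \<in> set w \<longleftrightarrow> 2 \<le> x \<and> x \<le> n" for x by (simp add: w'(2))
  obtain k r where kr: "w = k # r" using n mem[of n] by (cases w) auto
  have k: "2 \<le> k" "k < n" "n \<in> set r" using mem[of k] mem[of n] kr ne n by auto
  then obtain k' r' where r: "r = k' # r'" by (cases r) auto
  have "k' \<noteq> k" using w'(1) kr r by auto
  then consider "k' < k" | "k < k'" by linarith
  then show False
  proof cases
    case 1
    then have "n \<in> set r'" using k r by auto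
    then show False using w'(3) kr r 1 k by auto
  next
    case 2
    \<comment> \<open>The closing 1 forces the walk to come down below \<open>k\<close>.\<close>
    have "\<exists>x y. (x, y) \<in> edges (r @ [1]) \<and> k < x \<and> y < k"
      by (rule edge_crossing) (use r 2 k w'(1) kr in auto)
    then obtain x y where xy: "(x, y) \<in> edges (r @ [1])" "k < x" "y < k" by auto
    \<comment> \<open>The steps \<open>(1, k)\<close>, \<open>(k, k')\<close>, \<open>(x, y)\<close>
      start at \<open>1 < k < x\<close> and have values \<open>y < k < k'\<close>, a pattern
      231.\<close>
    show False
      by (rule av231_D[OF w'(4), of 1 k k k' x y]) (use xy 2 k r kr in auto)
  qed
qed

text \<open>The only step leaving the block \<open>{j..n}\<close> is \<open>(b, t)\<close>, from the
  last letter of the zigzag to the letter after it. A pattern 231 would have to lie within the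
  zigzag, where steps decrease, or within \<open>d @ [1]\<close>.\<close>

lemma avoider_words_append:
  assumes d: "d \<in> avoider_words (j - 1)" and j: "2 \<le> j" "j \<le> n"
  shows "zig j (Suc n - j) @ d \<in> avoider_words n"
proof -
  define m where "m = n - j"
  have m: "Suc n - j = Suc m" "n = j + m" using j by (auto simp: m_def)
  define z where "z = zig j (Suc m)"
  have z: "z \<noteq> []" "hd z = n" "set z = {j..n}" "distinct z"
    using m by (simp_all add: z_def set_zig_zag distinct_zig_zag atLeastLessThanSuc_atLeastAtMost
        flip: zig.simps) auto
  have d': "distinct d" "set d = {2..j - 1}" "av213 d" "av231 (edges (1 # d @ [1]))"
    using d by (auto simp: avoider_words_def)
  define b where "b = last z"
  \<comment> \<open>If \<open>d\<close> is empty, the zigzag is followed by the closing 1 and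
    \<open>t = 1\<close>.\<close>
  define t where "t = hd (d @ [1])"
  have b: "b \<in> {j..n}" using last_in_set[OF z(1)] unfolding z(3) b_def .
  have mem_d: "x \<in> set d \<longleftrightarrow> 2 \<le> x \<and> x < j" for x using j by (simp add: d'(2) less_eq_Suc_le[symmetric] Suc_le_eq) linarith
  have mem_z: "x \<in> set z \<longleftrightarrow> j \<le> x \<and> x \<le> n" for x by (simp add: z(3))
  have t: "t < j" using mem_d[of t] j by (cases d) (auto simp: t_def)
  have E: "edges (1 # (z @ d) @ [1]) = insert (1, n) (insert (b, t) (edges z \<union> edges (d @ [1])))"
    using z by (simp add: edges_Cons edges_append b_def t_def insert_commute)
  have Ed: "av231 (edges (d @ [1]))"
    by (rule av231_mono[OF d'(4) edges_subset_Cons])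
  \<comment> \<open>A nonempty \<open>d\<close> begins with its largest letter \<open>j - 1\<close>,
    so no step inside \<open>d @ [1]\<close> ends above \<open>t\<close>.\<close>
  have ed: "2 \<le> x \<and> x < j \<and> y < j \<and> y \<le> t" if "(x, y) \<in> edges (d @ [1])" for x y
  proof -
    have x: "x \<in> set d" and y: "y \<in> set (tl (d @ [1]))"
      using that edges_subset[of "d @ [1]"] by auto
    have "2 \<le> j - 1" using x mem_d[of x] by auto
    then have "hd d = j - 1" using hd_avoider_word[OF d] by simp
    then have "t = j - 1" using x by (cases d) (auto simp: t_def)
    moreover have "y \<in> set d \<or> y = 1" using y by (cases d) auto
    ultimately show ?thesis using x mem_d[of x] mem_d[of y] j by auto
  qed
  have ez: "j \<le> x \<and> x \<le> n \<and> x \<noteq> b \<and> j \<le> y" if "(x, y) \<in> edges z" for x y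
  proof -
    have xy: "x \<in> set (butlast z)" "y \<in> set (tl z)"
      using that edges_subset[of z] by auto
    have "z = butlast z @ [b]" using z b_def by simp
    then have "b \<notin> set (butlast z)" using z(4) by (metis distinct_append disjoint_iff list.set_intros(1))
    moreover have "x \<in> set z" "y \<in> set z" using xy z(1) by (auto dest: in_set_butlastD list.set_sel(2))
    ultimately show ?thesis using xy mem_z[of x] mem_z[of y] by auto
  qed
  have dz: "decreasing_edges (edges z)" unfolding z_def by (rule decreasing_edges_zig_zag)
  have "av231 (edges (1 # (z @ d) @ [1]))"
    unfolding av231_def
  proof (clarify)
    fix x1 y1 x2 y2 x3 y3
    assume e: "(x1, y1) \<in> edges (1 # (z @ d) @ [1])" "(x2, y2) \<in> edges (1 # (z @ d) @ [1])"
      "(x3, y3) \<in> edges (1 # (z @ d) @ [1])" and o: "x1 < x2" "x2 < x3" "y3 < y1" "y1 < y2"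
    have c: "(x = 1 \<and> y = n) \<or> (x = b \<and> y = t) \<or> (x, y) \<in> edges z \<or> (x, y) \<in> edges (d @ [1])"
      if "(x, y) \<in> edges (1 # (z @ d) @ [1])" for x y using that unfolding E by auto
    have le: "1 \<le> x \<and> y \<le> n" if "(x, y) \<in> edges (1 # (z @ d) @ [1])" for x y

    proof -
      have "y \<in> set ((z @ d) @ [1])" using that edges_subset[of "1 # (z @ d) @ [1]"] by auto
      then have "y \<le> n" using mem_z[of y] mem_d[of y] j by auto
      then show ?thesis using c[OF that] ed[of x y] ez[of x y] j b by auto
    qed
    \<comment> \<open>The step from 1 has the largest value \<open>n\<close>, so it cannot be the 2
      of the pattern.\<close>
    have x1: "x1 \<noteq> 1"
    proof
      assume "x1 = 1"
      then have "y1 = n" using c[OF e(1)] ed[of x1 y1] ez[of x1 y1] j b by auto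
      then show False using le[OF e(2)] o by auto
    qed
    have x23: "x2 \<noteq> 1" "x3 \<noteq> 1" using x1 o le[OF e(1)] by auto
    show False
    proof (cases "x1 < j")
      case True
      then have 1: "(x1, y1) \<in> edges (d @ [1])" using c[OF e(1)] x1 ez[of x1 y1] b by auto
      then have y1: "y1 \<le> t" "y1 < j" using ed by auto
      show False
      proof (cases "x3 < j")
        case t3: True
        then have "(x2, y2) \<in> edges (d @ [1])" "(x3, y3) \<in> edges (d @ [1])"
          using c[OF e(2)] c[OF e(3)] x23 ez[of x2 y2] ez[of x3 y3] b o by auto
        with 1 Ed show False using o av231_D by blast
      next
        \<comment> \<open>Only \<open>(b, t)\<close> leads from the block to a value below
          \<open>j\<close>, and \<open>t\<close> is too large to be the 1 of the pattern.\<close>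
        case False
        then have "x3 = b" "y3 = t"
          using c[OF e(3)] x23 ez[of x3 y3] ed[of x3 y3] o y1 by auto
        with y1 o show False by simp
      qed
    next
      case False
      have c': "(x = b \<and> y = t) \<or> (x, y) \<in> edges z"
        if "(x, y) \<in> edges (1 # (z @ d) @ [1])" "j \<le> x" for x y
        using c[OF that(1)] that(2) ed[of x y] j by auto
      \<comment> \<open>Among the steps starting in the block, \<open>(b, t)\<close> has the
        smallest value, so it can be neither the 2 nor the 3.\<close>
      have c1: "(x1, y1) \<in> edges z"
        using c'[OF e(1)] c'[OF e(3)] False o t ez[of x3 y3] by auto
      have c2: "(x2, y2) \<in> edges z"
        using c'[OF e(2)] c1 False o t ez[of x1 y1] by auto
      show False using decreasing_edges_D[OF dz c1 c2] o by simp
    qed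
  qed
  moreover have "av213 (z @ d)"
    by (rule av213_append)
      (use d'(3) mem_z mem_d av213_zig_zag(1)[of j "Suc m", folded z_def] in auto)
  moreover have "distinct (z @ d)"
    using d'(1) z(4) mem_z mem_d by auto
  moreover have "set (z @ d) = {2..n}"
  proof (rule set_eqI)
    show "x \<in> set (z @ d) \<longleftrightarrow> x \<in> {2..n}" for x
      using mem_z[of x] mem_d[of x] j by auto
  qed
  ultimately show ?thesis
    unfolding m(1) z_def[symmetric] by (simp add: avoider_words_def)
qed

text \<open>Excluding \<open>j = n - 1\<close> makes the later count disjoint: the zigzag
  \<open>n, n - 1\<close> followed by \<open>d\<close> is also the block \<open>{n}\<close> followed
  by the avoider word \<open>(n - 1) # d\<close>.\<close>

lemma avoider_words_split:
  assumes w: "w \<in> avoider_words n" and n: "2 \<le> n"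
  shows "\<exists>j d. 2 \<le> j \<and> j \<le> n \<and> j \<noteq> n - 1 \<and> d \<in> avoider_words (j - 1) \<and> w = zig j (Suc n - j) @ d"
proof -
  have w': "distinct w" "set w = {2..n}" "av213 w" "av231 (edges (1 # w @ [1]))"
    using w by (auto simp: avoider_words_def)
  have hd: "hd w = n" by (rule hd_avoider_word[OF w n])
  have mem: "x \<in> set w \<longleftrightarrow> 2 \<le> x \<and> x \<le> n" for x by (simp add: w'(2))
  obtain r where r: "w = n # r" using hd mem[of n] n by (cases w) auto
  have "set r = {2..n} - {n}"
    using set_tail[OF w'(1,2)[unfolded r]] .
  also have "\<dots> = {2..n - 1}" by auto
  finally have set_r: "set r = {2..n - 1}" .
  have mem_r: "x \<in> set r \<longleftrightarrow> 2 \<le> x \<and> x < n" for x using n by (simp add: set_r) linarith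
  show ?thesis
  proof (cases "r = [] \<or> hd r = n - 1")
    case True
    \<comment> \<open>Deleting \<open>n\<close> creates the single new step
      \<open>(1, hd (r @ [1]))\<close>. Its value is the largest, so it is not the 2; its start is
      the smallest, so it is not the 3 or the 1.\<close>
    have "av231 (edges (1 # r @ [1]))"
      unfolding av231_def
    proof clarify
      fix x1 y1 x2 y2 x3 y3
      assume e: "(x1, y1) \<in> edges (1 # r @ [1])" "(x2, y2) \<in> edges (1 # r @ [1])"
        "(x3, y3) \<in> edges (1 # r @ [1])" and o: "x1 < x2" "x2 < x3" "y3 < y1" "y1 < y2"
      have s: "1 \<le> x \<and> y \<le> hd (r @ [1])" if "(x, y) \<in> edges (1 # r @ [1])" for x y
      proof -
        have "x \<in> set (1 # r)" "y \<in> set (r @ [1])"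
          using that edges_subset[of "1 # r @ [1]"] by auto
        moreover have "y \<le> n - 1" if "r \<noteq> []"
          using calculation(2) mem_r[of y] n by auto
        ultimately show ?thesis using mem_r[of x] True by (cases "r = []") auto
      qed
      have o': "x1 \<noteq> 1" "x2 \<noteq> 1" "x3 \<noteq> 1"
      proof -
        show "x1 \<noteq> 1"
        proof
          assume "x1 = 1"
          moreover have "x \<in> set r" if "(x, y) \<in> edges (r @ [1])" for x y
            using that edges_subset[of "r @ [1]"] by auto
          ultimately have "y1 = hd (r @ [1])" using e(1) mem_r[of 1] by (auto simp: edges_Cons)
          with s[OF e(2)] o show False by simp
        qed
        then show "x2 \<noteq> 1" "x3 \<noteq> 1" using s[OF e(1)] o by auto
      qed
      have "edges (r @ [1]) \<subseteq> edges (1 # w @ [1])" by (auto simp: r edges_Cons)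
      moreover have "(x1, y1) \<in> edges (r @ [1])" "(x2, y2) \<in> edges (r @ [1])" "(x3, y3) \<in> edges (r @ [1])"
        using e o' by (auto simp: edges_Cons)
      ultimately show False using av231_D[OF w'(4)] o by blast
    qed
    then have "r \<in> avoider_words (n - 1)"
      using w' r set_r by (simp add: avoider_words_def)
    moreover have "w = zig n (Suc n - n) @ r" using r by (simp add: Suc_diff_le)
    ultimately show ?thesis using n by (intro exI[of _ n]) auto
  next
    case False
    then obtain j s where s: "r = j # s" by (cases r) auto
    have j: "2 \<le> j" "j < n - 1" "distinct s" "j \<notin> set s" "n \<notin> set s"
      using mem_r[of j] s False w'(1) r by auto
    have mem_s: "x \<in> set s \<longleftrightarrow> 2 \<le> x \<and> x < n \<and> x \<noteq> j" for x
      using mem_r[of x] s j by auto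
    define u where "u = filter (\<lambda>y. j < y) s"
    define d where "d = filter (\<lambda>y. y < j) s"
    have sud: "s = u @ d"
      unfolding u_def d_def by (rule split_big_small) (use w'(3) r s j in auto)
    have mem_u: "x \<in> set u \<longleftrightarrow> j < x \<and> x < n" for x
      using mem_s[of x] j by (auto simp: u_def)
    have mem_d: "x \<in> set d \<longleftrightarrow> 2 \<le> x \<and> x < j" for x
      using mem_s[of x] j by (auto simp: d_def)
    have dist: "distinct u" "distinct d" using j by (simp_all add: u_def d_def)
    have une: "u \<noteq> []" using mem_u[of "n - 1"] j by auto
    define t where "t = hd (d @ [1])"
    have t: "t < j" using mem_d[of t] j by (cases d) (auto simp: t_def)
    define b where "b = last u"
    have b: "j < b" "b < n" using last_in_set[OF une] mem_u[of b] by (simp_all add: b_def)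
    have E: "edges (1 # w @ [1]) = {(1, n), (n, j), (b, t)} \<union> edges (j # u) \<union> edges (d @ [1])"
      using une by (auto simp: r s sud edges_Cons edges_append b_def t_def)
    have eju: "j \<le> x \<and> x < n \<and> j < y \<and> y < n" if "(x, y) \<in> edges (j # u)" for x y
    proof -
      have "x \<in> set (butlast (j # u))" "y \<in> set u"
        using that edges_subset[of "j # u"] by auto
      then show ?thesis using in_set_butlastD[of x "j # u"] mem_u[of x] mem_u[of y] j by auto
    qed
    \<comment> \<open>an ascent would form the pattern 231 with the step \<open>(n, j)\<close>\<close>
    have dju: "decreasing_edges (edges (j # u))"
      unfolding decreasing_edges_def
    proof clarify
      fix x y x' y' assume e: "(x, y) \<in> edges (j # u)" "(x', y') \<in> edges (j # u)" "x < x'"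
      have "y' \<noteq> y"
        using edges_target_inj[of "j # u" x y x'] e dist mem_u[of j] by auto
      moreover have "\<not> y < y'"
      proof
        assume "y < y'"
        show False
          by (rule av231_D[OF w'(4), of x y x' y' n j]) (use e eju[OF e(1)] eju[OF e(2)] \<open>y < y'\<close> E j in auto)
      qed
      ultimately show "y' < y" by simp
    qed
    have "set (j # u) = {j..<j + (n - j)}"
    proof (rule set_eqI)
      show "x \<in> set (j # u) \<longleftrightarrow> x \<in> {j..<j + (n - j)}" for x
        using mem_u[of x] j by auto
    qed
    then have zj: "j # u = zag j (n - j)"
      using dist mem_u[of j] dju by (intro decreasing_edges_imp_zig_zag(2)) simp_all
    moreover have "Suc n - j = Suc (n - j)" using j by simp
    ultimately have wz: "w = zig j (Suc n - j) @ d" using j by (simp add: r s sud flip: zj)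
    have hu: "hd u = n - 1"
    proof -
      obtain m where "n - j = Suc (Suc m)" using j by (cases "n - j"; cases "n - j - 1") auto
      then show ?thesis using zj j by auto
    qed
    \<comment> \<open>a larger value \<open>y\<close> would form the pattern 231 with the steps \<open>(j, n - 1)\<close> and \<open>(b, t)\<close>\<close>
    have tmax: "y \<le> t" if y: "y \<in> set (d @ [1])" for y
    proof (rule ccontr)
      assume "\<not> y \<le> t"
      then have ty: "t < y" by simp
      then have "y \<in> set (tl (d @ [1]))" using y by (cases d) (auto simp: t_def)
      then obtain x where x: "x \<in> set (butlast (d @ [1]))" "(x, y) \<in> edges (d @ [1])"
        using edge_into by metis
      have "x < j" "y < j" using x mem_d[of x] mem_d[of y] y j by auto
      then show False
        using av231_D[OF w'(4)[unfolded E], of x y j "n - 1" b t] x(2) ty b j hu une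
        by (auto simp: edges_Cons)
    qed
    have "av231 (edges (1 # d @ [1]))"
      unfolding av231_def
    proof clarify
      fix x1 y1 x2 y2 x3 y3
      assume e: "(x1, y1) \<in> edges (1 # d @ [1])" "(x2, y2) \<in> edges (1 # d @ [1])"
        "(x3, y3) \<in> edges (1 # d @ [1])" and o: "x1 < x2" "x2 < x3" "y3 < y1" "y1 < y2"
      have sub: "x \<in> set (1 # d) \<and> y \<in> set (d @ [1])" if "(x, y) \<in> edges (1 # d @ [1])" for x y
        using that edges_subset[of "1 # d @ [1]"] by auto
      have mt: "x \<in> set d" "y \<in> set (d @ [1])" if "(x, y) \<in> edges (d @ [1])" for x y
        using that edges_subset[of "d @ [1]"] by (cases d; auto)+
      \<comment> \<open>Only \<open>(1, t)\<close> is not a step of \<open>w\<close>. By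
        \<open>tmax\<close> its value is the largest, so it cannot be the 2 of the pattern.\<close>
      have nt: "y1 \<noteq> t" "y3 \<noteq> t" "y1 < t" using sub[OF e(2)] tmax[of y2] o by auto
      have x1: "x1 \<noteq> 1"
        using e(1) nt mt(1)[of x1 y1] mem_d[of 1] by (auto simp: edges_Cons t_def)
      then have "x1 \<noteq> 1" "x2 \<noteq> 1" "x3 \<noteq> 1" using sub[OF e(1)] mem_d[of x1] o by auto
      then have "(x1, y1) \<in> edges (d @ [1])" "(x2, y2) \<in> edges (d @ [1])" "(x3, y3) \<in> edges (d @ [1])"
        using e by (auto simp: edges_Cons)
      then show False using av231_D[OF w'(4)[unfolded E], of x1 y1 x2 y2 x3 y3] o by auto
    qed
    moreover have "set d = {2..j - 1}"
    proof (rule set_eqI)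
      show "x \<in> set d \<longleftrightarrow> x \<in> {2..j - 1}" for x
        using mem_d[of x] by auto
    qed
    ultimately have "d \<in> avoider_words (j - 1)"
      using dist av213_appendD[of "n # j # u" d] w' by (auto simp: avoider_words_def r s sud)
    with wz j show ?thesis by (intro exI[of _ j] exI[of _ d]) auto
  qed
qed

section \<open>Counting avoider words\<close>

lemma finite_avoider_words: "finite (avoider_words n)"
  by (rule finite_subset[OF _ finite_subset_distinct[of "{2..n}"]]) (auto simp: avoider_words_def)

lemma avoider_words_1: "avoider_words 1 = {[]}"
  by (auto simp: avoider_words_def av231_def)

lemma avoider_words_rec:
  assumes "2 \<le> n"
  shows "avoider_words n = (\<Union>j\<in>{2..n} - {n - 1}. (@) (zig j (Suc n - j)) ` avoider_words (j - 1))"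
proof (intro equalityI subsetI)
  fix w assume "w \<in> avoider_words n"
  from avoider_words_split[OF this assms] obtain j d where
    "2 \<le> j" "j \<le> n" "j \<noteq> n - 1" "d \<in> avoider_words (j - 1)" "w = zig j (Suc n - j) @ d" by blast
  then show "w \<in> (\<Union>j\<in>{2..n} - {n - 1}. (@) (zig j (Suc n - j)) ` avoider_words (j - 1))"
    by (intro UN_I[of j]) simp_all
next
  fix w assume "w \<in> (\<Union>j\<in>{2..n} - {n - 1}. (@) (zig j (Suc n - j)) ` avoider_words (j - 1))"
  then obtain j d where "j \<in> {2..n}" "d \<in> avoider_words (j - 1)" "w = zig j (Suc n - j) @ d" by blast
  then show "w \<in> avoider_words n" using avoider_words_append by simp
qed

text \<open>
  The second letter determines the block, so the union in \<open>avoider_words_rec\<close> is disjoint.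
\<close>

lemma second_entry:
  assumes n: "3 \<le> n" and j: "2 \<le> j" "j \<le> n" "j \<noteq> n - 1" and d: "d \<in> avoider_words (j - 1)"
  shows "(zig j (Suc n - j) @ d) ! 1 = (if j = n then n - 1 else j)"
proof (cases "j = n")
  case True
  have "hd d = n - 1" using hd_avoider_word[OF d] True n by simp
  moreover have "set d = {2..n - 1}" using d True by (simp add: avoider_words_def)
  then have "d \<noteq> []" using n by (cases d) simp_all
  ultimately show ?thesis using True by (simp add: Suc_diff_le hd_conv_nth)
next
  case False
  \<comment> \<open>Here \<open>j \<le> n - 2\<close>, so the zigzag has at least three letters and
    its second one is its minimum \<open>j\<close>.\<close>
  then obtain k where k: "Suc n - j = Suc (Suc (Suc k))"
    using j by (metis Suc_diff_Suc Suc_diff_le diff_Suc_1 le_neq_implies_less less_Suc_eq_le diff_self_eq_0 not_less_eq_eq Suc_lessI)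
  show ?thesis unfolding k using False by simp
qed

lemma card_avoider_words:
  assumes "2 \<le> n"
  shows "card (avoider_words n) = (\<Sum>j\<in>{2..n} - {n - 1}. card (avoider_words (j - 1)))"
proof -
  let ?B = "\<lambda>j. (@) (zig j (Suc n - j)) ` avoider_words (j - 1)"
  have disj: "?B i \<inter> ?B j = {}" if ij: "i \<in> {2..n} - {n - 1}" "j \<in> {2..n} - {n - 1}" "i \<noteq> j" for i j
  proof (rule ccontr)
    assume "?B i \<inter> ?B j \<noteq> {}"
    then obtain d e where de: "d \<in> avoider_words (i - 1)" "e \<in> avoider_words (j - 1)"
      "zig i (Suc n - i) @ d = zig j (Suc n - j) @ e" by blast
    have "3 \<le> n" using ij by auto
    then have "(if i = n then n - 1 else i) = (if j = n then n - 1 else j)"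
      using second_entry[of n i d] second_entry[of n j e] de ij by simp
    then show False using ij by (auto split: if_splits)
  qed
  have "card (avoider_words n) = card (\<Union>j\<in>{2..n} - {n - 1}. ?B j)"
    using avoider_words_rec[OF assms] by (rule arg_cong)
  also have "\<dots> = (\<Sum>j\<in>{2..n} - {n - 1}. card (?B j))"
  proof (rule card_UN_disjoint)
    show "\<forall>j\<in>{2..n} - {n - 1}. finite (?B j)"
      using finite_avoider_words by blast
    show "\<forall>i\<in>{2..n} - {n - 1}. \<forall>j\<in>{2..n} - {n - 1}. i \<noteq> j \<longrightarrow> ?B i \<inter> ?B j = {}"
      using disj by blast
  qed simp
  also have "\<dots> = (\<Sum>j\<in>{2..n} - {n - 1}. card (avoider_words (j - 1)))"
    by (intro sum.cong refl card_image) (simp add: inj_on_def)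
  finally show ?thesis .
qed

lemma card_avoider_words_base:
  "card (avoider_words 1) = 1" "card (avoider_words 2) = 1" "card (avoider_words 3) = 1"
proof -
  show 1: "card (avoider_words 1) = 1" by (simp only: avoider_words_1) simp
  have "{2..2::nat} - {2 - 1} = {2}" by auto
  with card_avoider_words[of 2] 1 show 2: "card (avoider_words 2) = 1" by simp
  have "{2..3::nat} - {3 - 1} = {3}" by auto
  with card_avoider_words[of 3] 2 show "card (avoider_words 3) = 1" by simp
qed

text \<open>The first summand belongs to the block made of the largest letter alone; the other
  blocks are reindexed by \<open>i = j - 1\<close>.\<close>

lemma card_avoider_words_sum:
  "card (avoider_words (n + 3)) = card (avoider_words (n + 2)) + (\<Sum>i = 1..n. card (avoider_words i))"
proof -
  have "{2..n + 3} - {n + 3 - 1} = insert (n + 3) {Suc 1..Suc n}" by auto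
  with card_avoider_words[of "n + 3"]
  have "card (avoider_words (n + 3)) =
      card (avoider_words (n + 3 - 1)) + (\<Sum>j = Suc 1..Suc n. card (avoider_words (j - 1)))"
    by simp
  then show ?thesis by (simp only: sum.shift_bounds_cl_Suc_ivl) (simp add: numeral_eq_Suc)
qed

text \<open>The difference of two consecutive instances of \<open>card_avoider_words_sum\<close>
  leaves one summand; the additive form avoids truncated subtraction.\<close>

lemma card_avoider_words_recurrence:
  "card (avoider_words (n + 4)) + card (avoider_words (n + 2)) =
     2 * card (avoider_words (n + 3)) + card (avoider_words (n + 1))"
  using card_avoider_words_sum[of n] card_avoider_words_sum[of "n + 1"] by (simp add: numeral_eq_Suc)

section \<open>The closed form, indexed by \<open>m = n - 1\<close>\<close>

definition binomial_sum :: "nat \<Rightarrow> nat" where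
  "binomial_sum m = (\<Sum>k = 0..m div 3. (m - k) choose (2 * k))"

text \<open>For \<open>k > m div 3\<close> the lower index \<open>2 * k\<close> exceeds
  \<open>m - k\<close>. This lets sums for different \<open>m\<close> share an upper limit.\<close>

lemma binomial_sum_eq:
  assumes "m div 3 \<le> K"
  shows "binomial_sum m = (\<Sum>k = 0..K. (m - k) choose (2 * k))"
  unfolding binomial_sum_def
  by (rule sum.mono_neutral_left) (use assms in \<open>auto intro!: binomial_eq_0\<close>)

text \<open>By Pascal's rule applied twice, a second difference in the upper index lowers the lower
  index by two.\<close>

lemma binomial_second_difference:
  "(Suc (Suc q) choose Suc (Suc r)) + (q choose Suc (Suc r)) = 2 * (Suc q choose Suc (Suc r)) + (q choose r)"
  by simp

lemma binomial_sum_recurrence: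
  "binomial_sum (m + 3) + binomial_sum (m + 1) = 2 * binomial_sum (m + 2) + binomial_sum m"
proof -
  define M where "M = m div 3"
  have le: "(m + 3) div 3 \<le> Suc M" "(m + 2) div 3 \<le> Suc M" "(m + 1) div 3 \<le> Suc M" "m div 3 \<le> M" "M \<le> m"
    by (simp_all add: M_def)
  have pascal: "(m + 3 - Suc i choose (2 * Suc i)) + (m + 1 - Suc i choose (2 * Suc i))
      = 2 * (m + 2 - Suc i choose (2 * Suc i)) + (m - i choose (2 * i))" if "i \<le> M" for i
  proof -
    have "m + 3 - Suc i = Suc (Suc (m - i))" "m + 2 - Suc i = Suc (m - i)" "m + 1 - Suc i = m - i"
      "2 * Suc i = Suc (Suc (2 * i))" using that le(5) by simp_all
    then show ?thesis by (simp only: binomial_second_difference)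
  qed
  \<comment> \<open>The 2 collects the two terms with \<open>k = 0\<close>; the remaining terms are
    shifted to \<open>k = Suc i\<close>.\<close>
  have "binomial_sum (m + 3) + binomial_sum (m + 1) =
      2 + (\<Sum>i = 0..M. (m + 3 - Suc i choose (2 * Suc i)) + (m + 1 - Suc i choose (2 * Suc i)))"
    by (simp only: binomial_sum_eq[OF le(1)] binomial_sum_eq[OF le(3)] sum.atLeast0_atMost_Suc_shift sum.distrib o_def) simp
  also have "\<dots> = 2 + (\<Sum>i = 0..M. 2 * (m + 2 - Suc i choose (2 * Suc i)) + (m - i choose (2 * i)))"
    using pascal by simp
  also have "\<dots> = 2 * binomial_sum (m + 2) + binomial_sum m"
    by (simp only: binomial_sum_eq[OF le(2)] binomial_sum_eq[OF le(4)] sum.atLeast0_atMost_Suc_shift sum.distrib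
        sum_distrib_left[symmetric] o_def) simp
  finally show ?thesis .
qed

lemma binomial_sum_base: "binomial_sum 0 = 1" "binomial_sum 1 = 1" "binomial_sum 2 = 1"
  by (simp_all add: binomial_sum_def)

lemma card_avoider_words_eq_binomial_sum: "card (avoider_words (m + 1)) = binomial_sum m"
proof (induction m rule: less_induct)
  case (less m)
  consider "m = 0" | "m = 1" | "m = 2" | k where "m = k + 3"
    by (metis One_nat_def Suc_1 add.commute le_Suc_ex less_2_cases_iff less_Suc_eq not_less numeral_3_eq_3)
  then show ?case
  proof cases
    case (4 k)
    then have "card (avoider_words (k + 1)) = binomial_sum k"
      "card (avoider_words (k + 2)) = binomial_sum (k + 1)"
      "card (avoider_words (k + 3)) = binomial_sum (k + 2)"
      using less[of k] less[of "k + 1"] less[of "k + 2"] by (simp_all add: numeral_eq_Suc)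
    then have "card (avoider_words (k + 4)) = binomial_sum (k + 3)"
      using card_avoider_words_recurrence[of k] binomial_sum_recurrence[of k] by simp
    moreover have "m + 1 = k + 4" using 4 by simp
    ultimately show ?thesis using 4 by (simp only:)
  qed (use card_avoider_words_base binomial_sum_base in \<open>simp_all add: numeral_eq_Suc\<close>)
qed

section \<open>Translating list patterns into the word conditions\<close>

lemma contains_pattern_triple:
  "contains_pattern w [a, b, c] \<longleftrightarrow>
     (\<exists>i j k. i < j \<and> j < k \<and> k < length w \<and>
        (w ! i < w ! j \<longleftrightarrow> a < b) \<and> (w ! j < w ! i \<longleftrightarrow> b < a) \<and>
        (w ! i < w ! k \<longleftrightarrow> a < c) \<and> (w ! k < w ! i \<longleftrightarrow> c < a) \<and>
        (w ! j < w ! k \<longleftrightarrow> b < c) \<and> (w ! k < w ! j \<longleftrightarrow> c < b))" (is "_ \<longleftrightarrow> ?R")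
proof
  assume "contains_pattern w [a, b, c]"
  then obtain f where f: "strict_mono_on {..<3} f" "f ` {..<3} \<subseteq> {..<length w}"
    "\<And>i j. i < 3 \<Longrightarrow> j < 3 \<Longrightarrow> w ! f i < w ! f j \<longleftrightarrow> [a, b, c] ! i < [a, b, c] ! j"
    unfolding contains_pattern_def by (auto simp: numeral_3_eq_3)
  have "f 0 < f 1" "f 1 < f 2" using f(1) by (auto simp: strict_mono_on_def)
  moreover have "f 2 < length w" using f(2) by (simp add: image_subset_iff)
  moreover note f(3)[of 0 1] f(3)[of 1 0] f(3)[of 0 2] f(3)[of 2 0] f(3)[of 1 2] f(3)[of 2 1]
  ultimately have lt: "f 0 < f 1" "f 1 < f 2" "f 2 < length w"
    "w ! f 0 < w ! f 1 \<longleftrightarrow> a < b" "w ! f 1 < w ! f 0 \<longleftrightarrow> b < a" "w ! f 0 < w ! f 2 \<longleftrightarrow> a < c"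
    "w ! f 2 < w ! f 0 \<longleftrightarrow> c < a" "w ! f 1 < w ! f 2 \<longleftrightarrow> b < c" "w ! f 2 < w ! f 1 \<longleftrightarrow> c < b"
    by simp_all
  then show ?R by blast
next
  assume ?R
  then obtain i j k where ijk: "i < j" "j < k" "k < length w"
    "w ! i < w ! j \<longleftrightarrow> a < b" "w ! j < w ! i \<longleftrightarrow> b < a" "w ! i < w ! k \<longleftrightarrow> a < c" "w ! k < w ! i \<longleftrightarrow> c < a"
    "w ! j < w ! k \<longleftrightarrow> b < c" "w ! k < w ! j \<longleftrightarrow> c < b" by blast
  define f where "f = (\<lambda>t::nat. if t = 0 then i else if t = 1 then j else k)"
  have "strict_mono_on {..<3} f" using ijk(1,2) by (auto simp: strict_mono_on_def f_def)
  moreover have "f ` {..<3} \<subseteq> {..<length w}" using ijk(1-3) by (auto simp: f_def)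
  moreover have "w ! f s < w ! f t \<longleftrightarrow> [a, b, c] ! s < [a, b, c] ! t" if "s < 3" "t < 3" for s t
  proof -
    have "s \<in> {0, 1, 2}" "t \<in> {0, 1, 2}" using that by auto
    then show ?thesis by (elim insertE emptyE) (simp_all add: f_def ijk(4-9))
  qed
  ultimately show "contains_pattern w [a, b, c]"
    unfolding contains_pattern_def by (intro exI[of _ f]) (simp add: numeral_3_eq_3)
qed

lemma av213_iff_nth:
  "av213 w \<longleftrightarrow> \<not> (\<exists>i j k. i < j \<and> j < k \<and> k < length w \<and> w ! j < w ! i \<and> w ! i < w ! k)"
proof (induction w)
  case (Cons x xs)
  \<comment> \<open>An occurrence either has the head as its 2 or lies entirely in the tail.\<close>
  have ex: "(\<exists>i j k. i < j \<and> j < k \<and> k < length (x # xs) \<and> (x # xs) ! j < (x # xs) ! i \<and> (x # xs) ! i < (x # xs) ! k)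
     \<longleftrightarrow> (\<exists>j k. j < k \<and> k < length xs \<and> xs ! j < x \<and> x < xs ! k) \<or>
       (\<exists>i j k. i < j \<and> j < k \<and> k < length xs \<and> xs ! j < xs ! i \<and> xs ! i < xs ! k)" (is "?L \<longleftrightarrow> ?R1 \<or> ?R2")
  proof
    assume ?L
    then obtain i j k where ijk: "i < j" "j < k" "k < length (x # xs)"
      "(x # xs) ! j < (x # xs) ! i" "(x # xs) ! i < (x # xs) ! k" by blast
    obtain j' k' where "j = Suc j'" "k = Suc k'" using ijk(1,2) by (cases j; cases k) auto
    then show "?R1 \<or> ?R2" using ijk by (cases i) auto
  next
    assume "?R1 \<or> ?R2"
    then show ?L
    proof
      assume ?R1
      then obtain j k where "j < k" "k < length xs" "xs ! j < x" "x < xs ! k" by blast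
      then have "0 < Suc j" "Suc j < Suc k" "Suc k < length (x # xs)"
        "(x # xs) ! Suc j < (x # xs) ! 0" "(x # xs) ! 0 < (x # xs) ! Suc k" by simp_all
      then show ?L by blast
    next
      assume ?R2
      then obtain i j k where "i < j" "j < k" "k < length xs" "xs ! j < xs ! i" "xs ! i < xs ! k" by blast
      then have "Suc i < Suc j" "Suc j < Suc k" "Suc k < length (x # xs)"
        "(x # xs) ! Suc j < (x # xs) ! Suc i" "(x # xs) ! Suc i < (x # xs) ! Suc k" by simp_all
      then show ?L by blast
    qed
  qed
  have "sorted_wrt (\<lambda>a b. \<not> (a < x \<and> x < b)) xs \<longleftrightarrow> \<not> ?R1"
    unfolding sorted_wrt_iff_nth_less by blast
  then show ?case unfolding ex av213.simps Cons de_Morgan_disj by (rule arg_cong)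
qed simp

lemma avoids_213_iff: "avoids w [2, 1, 3] \<longleftrightarrow> av213 w"
  unfolding av213_iff_nth contains_pattern_triple
  by (intro arg_cong[where f = Not] ex_cong1) auto

text \<open>List positions count from 0 and arguments of \<open>p\<close> from 1, hence the shifts
  by \<open>Suc\<close> in the proof.\<close>

lemma avoids_231_one_line_iff:
  "avoids (one_line n p) [2, 3, 1] \<longleftrightarrow> av231 ((\<lambda>x. (x, p x)) ` {1..n})"
proof -
  have nth: "one_line n p ! i = p (Suc i)" if "i < n" for i
    using that by (simp add: one_line_def del: upt_Suc)
  have length: "length (one_line n p) = n" by (simp add: one_line_def)
  have "contains_pattern (one_line n p) [2, 3, 1] \<longleftrightarrow>
      (\<exists>i j k. i < j \<and> j < k \<and> k < n \<and> p (Suc k) < p (Suc i) \<and> p (Suc i) < p (Suc j))"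
    unfolding contains_pattern_triple
    by (intro ex_cong1) (auto simp: nth length)
  also have "\<dots> \<longleftrightarrow> \<not> av231 ((\<lambda>x. (x, p x)) ` {1..n})"
  proof
    assume "\<exists>i j k. i < j \<and> j < k \<and> k < n \<and> p (Suc k) < p (Suc i) \<and> p (Suc i) < p (Suc j)"
    then obtain i j k where "i < j" "j < k" "k < n" "p (Suc k) < p (Suc i)" "p (Suc i) < p (Suc j)"
      by blast
    then show "\<not> av231 ((\<lambda>x. (x, p x)) ` {1..n})"
      using av231_D[of "(\<lambda>x. (x, p x)) ` {1..n}" "Suc i" "p (Suc i)" "Suc j" "p (Suc j)" "Suc k" "p (Suc k)"]
      by (auto simp: image_iff)
  next
    assume "\<not> av231 ((\<lambda>x. (x, p x)) ` {1..n})"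
    then obtain x y z where "1 \<le> x" "z \<le> n" "x < y" "y < z" "p z < p x" "p x < p y"
      by (auto simp: av231_def)
    moreover from this have "x = Suc (x - 1)" "y = Suc (y - 1)" "z = Suc (z - 1)" by simp_all
    moreover from calculation have "x - 1 < y - 1" "y - 1 < z - 1" "z - 1 < n" by linarith+
    ultimately show "\<exists>i j k. i < j \<and> j < k \<and> k < n \<and> p (Suc k) < p (Suc i) \<and> p (Suc i) < p (Suc j)"
      by metis
  qed
  finally show ?thesis by simp
qed

section \<open>Cyclic permutations and their cycle words\<close>

lemma edges_map_upt: "edges (map f [0..<Suc n]) = (\<lambda>i. (f i, f (Suc i))) ` {..<n}"
proof (induction n)
  case (Suc n)
  have "edges (map f [0..<Suc n] @ [f (Suc n)]) =
      edges (map f [0..<Suc n]) \<union> insert (last (map f [0..<Suc n]), hd [f (Suc n)]) (edges [f (Suc n)])"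
    by (rule edges_append) simp_all
  then have "edges (map f [0..<Suc (Suc n)]) = edges (map f [0..<Suc n]) \<union> {(f n, f (Suc n))}"
    by simp
  then show ?case unfolding Suc by (simp add: lessThan_Suc)
qed simp

text \<open>\<open>funpow_dist1 p 1 1\<close> is the first return time of 1. The iterates before it
  list the orbit without repetition, so it equals \<open>n\<close>.\<close>

lemma cycle_notation_properties:
  assumes p: "p permutes {1..n}" "cyclic_on p {1..n}" and n: "1 \<le> n"
  shows "distinct (cycle_notation n p)" "set (cycle_notation n p) = {1..n}" "(p ^^ n) 1 = 1"
proof -
  have orb: "orbit p 1 = {1..n}" using orbit_cyclic_eq3[OF p(2), of 1] n by simp
  then have self: "1 \<in> orbit p 1" using n by simp
  define N where "N = funpow_dist1 p 1 1"
  have inj: "inj_on (\<lambda>i. (p ^^ i) 1) {0..<N}" and im: "{1..n} = (\<lambda>i. (p ^^ i) 1) ` {0..<N}"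
    using inj_on_funpow_dist1[OF self] orbit_conv_funpow_dist1[OF self] orb by (simp_all add: N_def)
  have "n = N" using card_image[OF inj] unfolding im[symmetric] by simp
  then show "distinct (cycle_notation n p)" "set (cycle_notation n p) = {1..n}"
    using inj im by (simp_all add: cycle_notation_def distinct_map)
  show "(p ^^ n) 1 = 1" using funpow_dist1_prop[OF self] \<open>n = N\<close> by (simp only: N_def)
qed

text \<open>The appended 1 supplies the step from the last entry back to the start.\<close>

lemma edges_cycle_notation:
  assumes p: "p permutes {1..n}" "cyclic_on p {1..n}" and n: "1 \<le> n"
  shows "edges (cycle_notation n p @ [1]) = (\<lambda>x. (x, p x)) ` {1..n}"
proof -
  have "cycle_notation n p @ [1] = map (\<lambda>i. (p ^^ i) 1) [0..<Suc n]"
    using cycle_notation_properties(3)[OF assms] by (simp add: cycle_notation_def)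
  then have "edges (cycle_notation n p @ [1]) = (\<lambda>i. ((p ^^ i) 1, (p ^^ Suc i) 1)) ` {..<n}"
    by (simp only: edges_map_upt)
  also have "\<dots> = (\<lambda>x. (x, p x)) ` set (cycle_notation n p)"
    by (simp add: cycle_notation_def image_image atLeast0LessThan)
  finally show ?thesis unfolding cycle_notation_properties(2)[OF assms] .
qed

lemma cycle_notation_Cons: "1 \<le> n \<Longrightarrow> cycle_notation n p = 1 # tl (cycle_notation n p)"
  by (cases n) (simp_all add: cycle_notation_def upt_conv_Cons del: upt_Suc)

lemma cyclic_avoider_iff:
  assumes p: "p permutes {1..n}" "cyclic_on p {1..n}" and n: "1 \<le> n"
  shows "avoids (one_line n p) [2, 3, 1] \<and> avoids (cycle_notation n p) [2, 1, 3] \<longleftrightarrow>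
    tl (cycle_notation n p) \<in> avoider_words n"
proof -
  define w where "w = tl (cycle_notation n p)"
  have c: "cycle_notation n p = 1 # w" unfolding w_def by (rule cycle_notation_Cons[OF n])
  note props = cycle_notation_properties[OF assms, unfolded c]
  have dw: "distinct w" "1 \<notin> set w" using props(1) by simp_all
  have "set w = {1..n} - {1}" by (rule set_tail[OF props(1,2)])
  also have "\<dots> = {2..n}" by auto
  finally have sw: "set w = {2..n}" .
  have "sorted_wrt (\<lambda>a b. \<not> (a < 1 \<and> 1 < b)) w" by (rule sorted_wrt_const) (simp add: sw)
  then have "av213 (1 # w) \<longleftrightarrow> av213 w" by simp
  then show ?thesis
    unfolding avoids_213_iff avoids_231_one_line_iff edges_cycle_notation[OF assms, symmetric]
    using dw sw by (auto simp: c avoider_words_def)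
qed

lemma ex_cycle_notation:
  assumes w: "distinct (1 # w)" "set (1 # w) = {1..n}"
  shows "\<exists>p. p permutes {1..n} \<and> cyclic_on p {1..n} \<and> cycle_notation n p = 1 # w"
proof -
  define p where "p = cycle_of_list (1 # w)"
  have len: "length (1 # w) = n" using distinct_card[OF w(1)] unfolding w(2) by simp
  have pow: "(p ^^ i) 1 = (1 # w) ! i" if "i < n" for i
  \<comment> \<open>Applying \<open>p\<close> to every letter rotates the list by one, so after
    \<open>i\<close> applications its head is the letter at position \<open>i\<close>.\<close>
  proof -
    have "(p ^^ i) 1 = hd (map (p ^^ i) (1 # w))" by simp
    also have "\<dots> = hd (rotate i (1 # w))"
      unfolding p_def by (simp only: cyclic_rotation[OF w(1)])
    also have "\<dots> = (1 # w) ! i" using that len by (subst hd_rotate_conv_nth) simp_all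
    finally show ?thesis .
  qed
  have cn: "cycle_notation n p = 1 # w"
    using pow len by (intro nth_equalityI) (simp_all add: cycle_notation_def)
  have perm: "p permutes {1..n}" using cycle_permutes[of "1 # w"] unfolding w(2) p_def .
  have "(p ^^ n) 1 = 1"
    using cycle_is_id_root[OF w(1)] unfolding len p_def[symmetric] by simp
  then have "orbit p 1 = {(p ^^ m) 1 | m. m < n}"
    using len by (intro orbit_altdef_bounded) auto
  also have "\<dots> = set (cycle_notation n p)" by (auto simp: cycle_notation_def)
  finally have "orbit p 1 = {1..n}" unfolding cn w(2) .
  then have "cyclic_on p {1..n}" using len by (intro cyclic_on_singleI[of 1]) auto
  with perm cn show ?thesis by blast
qed

text \<open>The word determines the graph of \<open>p\<close> on \<open>{1..n}\<close>, and
  \<open>p\<close> is the identity elsewhere; conversely each word closes up to an explicit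
  cycle.\<close>

lemma num_cyclic_avoiders_eq_card_words:
  assumes n: "1 \<le> n"
  shows "num_cyclic_avoiders n [2, 3, 1] [2, 1, 3] = card (avoider_words n)"
proof -
  let ?A = "cyclic_avoiders n [2, 3, 1] [2, 1, 3]"
  have A: "p \<in> ?A \<longleftrightarrow> p permutes {1..n} \<and> cyclic_on p {1..n} \<and> tl (cycle_notation n p) \<in> avoider_words n" for p
    using cyclic_avoider_iff[OF _ _ n] by (auto simp: cyclic_avoiders_def)
  have "bij_betw (\<lambda>p. tl (cycle_notation n p)) ?A (avoider_words n)"
  proof (rule bij_betwI')
    fix p q assume pq: "p \<in> ?A" "q \<in> ?A"
    show "tl (cycle_notation n p) = tl (cycle_notation n q) \<longleftrightarrow> p = q"
    proof
      assume "tl (cycle_notation n p) = tl (cycle_notation n q)"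
      then have "cycle_notation n p = cycle_notation n q"
        using cycle_notation_Cons[OF n, of p] cycle_notation_Cons[OF n, of q] by simp
      then have eq: "(\<lambda>x. (x, p x)) ` {1..n} = (\<lambda>x. (x, q x)) ` {1..n}"
        using edges_cycle_notation[OF _ _ n, of p] edges_cycle_notation[OF _ _ n, of q] pq unfolding A by simp
      show "p = q"
      proof
        fix x show "p x = q x"
        proof (cases "x \<in> {1..n}")
          case True
          then have "(x, p x) \<in> (\<lambda>x. (x, q x)) ` {1..n}" unfolding eq[symmetric] by blast
          then show ?thesis by blast
        next
          case False
          then show ?thesis using pq permutes_not_in unfolding A by metis
        qed
      qed
    qed simp
  next
    fix p assume "p \<in> ?A"
    then show "tl (cycle_notation n p) \<in> avoider_words n" unfolding A by blast
  next
    fix w assume w: "w \<in> avoider_words n"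
    then have w': "distinct w" "set w = {2..n}" by (simp_all add: avoider_words_def)
    have "insert 1 {2..n} = {1..n}" using n by auto
    then obtain p where p: "p permutes {1..n}" "cyclic_on p {1..n}" "cycle_notation n p = 1 # w"
      using ex_cycle_notation[of w n] w' by auto
    then have "p \<in> ?A" unfolding A using w by simp
    then show "\<exists>p \<in> ?A. w = tl (cycle_notation n p)"
      using p(3) by (intro bexI[of _ p]) simp_all
  qed
  then show ?thesis unfolding num_cyclic_avoiders_def by (rule bij_betw_same_card)
qed

theorem theorem3p20:
  fixes a :: "nat \<Rightarrow> nat"
  defines "a \<equiv> (\<lambda>n. num_cyclic_avoiders n [2, 3, 1] [2, 1, 3])"
  shows "a 1 = 1 \<and> a 2 = 1 \<and> a 3 = 1 \<and>
    (\<forall>n\<ge>4. int (a n) = 2 * int (a (n - 1)) - int (a (n - 2)) + int (a (n - 3))) \<and>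
    (\<forall>n\<ge>1. a n = (\<Sum>k = 0..(n - 1) div 3. (n - 1 - k) choose (2 * k)))"
proof -
  have a: "a n = card (avoider_words n)" if "1 \<le> n" for n
    using num_cyclic_avoiders_eq_card_words[OF that] by (simp only: a_def)
  have "int (a n) = 2 * int (a (n - 1)) - int (a (n - 2)) + int (a (n - 3))" if n: "4 \<le> n" for n
  proof -
    obtain k where k: "n = k + 4" using n by (metis add.commute le_Suc_ex)
    then have rec: "a n + a (k + 2) = 2 * a (k + 3) + a (k + 1)"
      using card_avoider_words_recurrence[of k] by (simp add: a)
    have shift: "n - 1 = k + 3" "n - 2 = k + 2" "n - 3 = k + 1" using k by simp_all
    show ?thesis unfolding shift using rec by linarith
  qed
  moreover have "a n = (\<Sum>k = 0..(n - 1) div 3. (n - 1 - k) choose (2 * k))" if n: "1 \<le> n" for n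
    using card_avoider_words_eq_binomial_sum[of "n - 1"] n by (simp add: a binomial_sum_def)
  moreover have "a 1 = 1" "a 2 = 1" "a 3 = 1"
    using card_avoider_words_base by (simp_all add: a)
  ultimately show ?thesis by blast
qed

end
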